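(* Let $E=(\mathbb{R}^n,B_E)$ and $F=(\mathbb{R}^n,B_F)$ be non-isometric $n$-dimensional normed spaces such that $B_E\subset B_F\subset d(E,F)\,B_E$. For $0\le\lambda\le 1$ let $E_\lambda=(\mathbb{R}^n,B_\lambda)$ and $F_\lambda=(\mathbb{R}^n,C_\lambda)$ be the normed spaces with unit balls $$B_\lambda=\bigl(d(E,F)^\lambda B_E\bigr)\cap B_F,\qquad C_\lambda=\mathrm{Conv}\Bigl[B_E\cup \tfrac{1}{d(E,F)^{1-\lambda}}B_F\Bigr].$$ Then the paths $\lambda\mapsto E_\lambda$ and $\lambda\mapsto F_\lambda$, $\lambda\in[0,1]$, are geodesics from $E$ to $F$ in $(BM_n,\log d)$.
   Context: All normed spaces are real. For $n$-dimensional normed spaces $E,F$, the (multiplicative) Banach-Mazur distance is $d(E,F)=\inf\{\|T\|\,\|T^{-1}\| : T:E\to F \text{ is an isomorphism}\}$. A normed space written $(\mathbb{R}^n,B)$ is $\mathbb{R}^n$ with the norm whose closed unit ball is the symmetric convex body $B$. $\mathrm{Conv}(S)$ is the convex hull of $S$. $BM_n$ is the set of isometry classes of $n$-dimensional normed spaces, with the metric $\log d$; a space is identified with its isometry class. In a metric space $(M,\rho)$, the length of a path $\gamma:[a,b]\to M$ is $L(\gamma)=\sup\sum_{i=1}^m\rho(\gamma(t_i),\gamma(t_{i-1}))$ over all partitions $a=t_0\le t_1\le\cdots\le t_m=b$; a geodesic from $x$ to $y$ is a path $\gamma$ starting at $x$, ending at $y$, with $L(\gamma)=\rho(x,y)$.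 *)

theory Defs
  imports "HOL-Analysis.Analysis"
begin

definition symmetric_convex_body :: "'a::euclidean_space set \<Rightarrow> bool" where
  "symmetric_convex_body B \<longleftrightarrow> convex B \<and> compact B \<and> interior B \<noteq> {} \<and> uminus ` B = B"

text \<open>The norm with closed unit ball \<open>B\<close> is the Minkowski functional of \<open>B\<close>; the lemmas
  \<open>body_norm_le_1_iff\<close>, \<open>body_norm_eq_0_iff\<close>, \<open>body_norm_scaleR\<close> and \<open>body_norm_triangle\<close>
  below show that it is a norm and that its closed unit ball is \<open>B\<close>.\<close>

definition body_norm :: "'a::euclidean_space set \<Rightarrow> 'a \<Rightarrow> real" where
  "body_norm B x = Inf {t. 0 \<le> t \<and> x \<in> (*\<^sub>R) t ` B}"

definition op_norm :: "'a::euclidean_space set \<Rightarrow> 'a set \<Rightarrow> ('a \<Rightarrow> 'a) \<Rightarrow> real" where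
  "op_norm B C T = (SUP x\<in>{x. body_norm B x \<le> 1}. body_norm C (T x))"

definition BM_dist :: "'a::euclidean_space set \<Rightarrow> 'a set \<Rightarrow> real" where
  "BM_dist B C = Inf {op_norm B C T * op_norm C B (inv T) | T. linear T \<and> bij T}"

definition isometric_bodies :: "'a::euclidean_space set \<Rightarrow> 'a set \<Rightarrow> bool" where
  "isometric_bodies B C \<longleftrightarrow>
     (\<exists>T. linear T \<and> bij T \<and> (\<forall>x. body_norm C (T x) = body_norm B x))"


lemma symmetric_convex_bodyE:
  assumes "symmetric_convex_body B"
  obtains r R where "0 < r" "0 < R" "cball 0 r \<subseteq> B" "B \<subseteq> cball 0 R"
proof -
  have cB: "convex B" and coB: "compact B" and iB: "interior B \<noteq> {}" and sB: "uminus ` B = B"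
    using assms by (auto simp: symmetric_convex_body_def)
  obtain x e where e: "0 < e" "cball x e \<subseteq> B"
    using iB by (meson ex_in_conv mem_interior_cball)
  have neg: "- y \<in> B" if "y \<in> B" for y
    using that sB by blast
  have "cball 0 e \<subseteq> B"
  proof
    fix y :: 'a assume "y \<in> cball 0 e"
    then have "x + y \<in> B" "x - y \<in> B"
      using e(2) by (auto simp: dist_norm subset_iff)
    then have "x + y \<in> B" "y - x \<in> B"
      using neg[of "x - y"] by auto
    then have "(1/2) *\<^sub>R (x + y) + (1/2) *\<^sub>R (y - x) \<in> B"
      using cB by (intro convexD) auto
    moreover have "(1/2) *\<^sub>R (x + y) + (1/2) *\<^sub>R (y - x) = y"
      by (simp add: scaleR_add_right scaleR_diff_right flip: scaleR_add_left)
    ultimately show "y \<in> B" by simp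
  qed
  moreover obtain R where "0 < R" "\<forall>x\<in>B. norm x \<le> R"
    using compact_imp_bounded[OF coB] by (auto simp: bounded_pos)
  then have "B \<subseteq> cball 0 R" by auto
  ultimately show thesis using e(1) \<open>0 < R\<close> that by blast
qed

lemma symmetric_convex_body_zero:
  "symmetric_convex_body B \<Longrightarrow> 0 \<in> B"
  by (erule symmetric_convex_bodyE) auto

lemma body_norm_set_mono:
  assumes "symmetric_convex_body B" "x \<in> (*\<^sub>R) s ` B" "0 \<le> s" "s \<le> t"
  shows "x \<in> (*\<^sub>R) t ` B"
proof (cases "t = 0")
  case False
  then have t: "0 < t" using assms by linarith
  obtain b where b: "b \<in> B" "x = s *\<^sub>R b" using assms by auto
  have "(s/t) *\<^sub>R b + (1 - s/t) *\<^sub>R 0 \<in> B"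
    using assms b t symmetric_convex_body_zero[OF assms(1)]
    by (intro convexD) (auto simp: symmetric_convex_body_def divide_simps)
  moreover have "x = t *\<^sub>R ((s/t) *\<^sub>R b + (1 - s/t) *\<^sub>R 0)"
    using b t by simp
  ultimately show ?thesis by blast
qed (use assms in auto)

lemma body_norm_set_nonempty:
  assumes "symmetric_convex_body B"
  shows "{t. 0 \<le> t \<and> x \<in> (*\<^sub>R) t ` B} \<noteq> {}"
proof -
  obtain r where r: "0 < r" "cball 0 r \<subseteq> B"
    using assms by (metis symmetric_convex_bodyE)
  show ?thesis
  proof (cases "x = 0")
    case True
    then have "x \<in> (*\<^sub>R) 0 ` B" using symmetric_convex_body_zero[OF assms] by force
    then show ?thesis by (metis (mono_tags, lifting) empty_iff mem_Collect_eq order_refl)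
  next
    case False
    have "(r / norm x) *\<^sub>R x \<in> B" using r False by (intro subsetD[OF r(2)]) auto
    moreover have "x = (norm x / r) *\<^sub>R ((r / norm x) *\<^sub>R x)" using r False by simp
    ultimately have "x \<in> (*\<^sub>R) (norm x / r) ` B" by blast
    then have "norm x / r \<in> {t. 0 \<le> t \<and> x \<in> (*\<^sub>R) t ` B}" using r(1) by simp
    then show ?thesis by blast
  qed
qed

lemma body_norm_nonneg: "symmetric_convex_body B \<Longrightarrow> 0 \<le> body_norm B x"
  unfolding body_norm_def by (rule cInf_greatest[OF body_norm_set_nonempty]) auto

lemma body_norm_le_iff:
  assumes "symmetric_convex_body B" "0 \<le> t"
  shows "body_norm B x \<le> t \<longleftrightarrow> x \<in> (*\<^sub>R) t ` B"
proof
  assume "x \<in> (*\<^sub>R) t ` B"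
  then show "body_norm B x \<le> t"
    unfolding body_norm_def using assms(2) by (intro cInf_lower) (auto intro: bdd_belowI[of _ 0])
next
  assume le: "body_norm B x \<le> t"
  have gt: "x \<in> (*\<^sub>R) s ` B" if "t < s" for s
  proof -
    have "Inf {t. 0 \<le> t \<and> x \<in> (*\<^sub>R) t ` B} < s" using le that by (simp add: body_norm_def)
    then obtain u where "0 \<le> u" "x \<in> (*\<^sub>R) u ` B" "u < s"
      using cInf_lessD[OF body_norm_set_nonempty[OF assms(1)]] by blast
    then show ?thesis using body_norm_set_mono[OF assms(1)] by (meson less_imp_le)
  qed
  have coB: "compact B" using assms by (auto simp: symmetric_convex_body_def)
  define s where "s n = t + inverse (real (Suc n))" for n
  have "\<exists>b\<in>B. x = s n *\<^sub>R b" for n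
    using gt[of "s n"] by (auto simp: s_def)
  then obtain b where b: "\<And>n. b n \<in> B" "\<And>n. x = s n *\<^sub>R b n" by metis
  obtain l k where l: "l \<in> B" "strict_mono k" "(b \<circ> k) \<longlonglongrightarrow> l"
    using coB b(1) unfolding compact_def by blast
  have "s \<longlonglongrightarrow> t + 0" unfolding s_def by (intro tendsto_intros LIMSEQ_inverse_real_of_nat)
  then have "(s \<circ> k) \<longlonglongrightarrow> t" using LIMSEQ_subseq_LIMSEQ l(2) by fastforce
  then have "(\<lambda>n. (s \<circ> k) n *\<^sub>R (b \<circ> k) n) \<longlonglongrightarrow> t *\<^sub>R l" using l(3) by (intro tendsto_intros)
  moreover have "(s \<circ> k) n *\<^sub>R (b \<circ> k) n = x" for n using b(2) by simp
  ultimately have "(\<lambda>n::nat. x) \<longlonglongrightarrow> t *\<^sub>R l" by simp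
  then have "x = t *\<^sub>R l" using LIMSEQ_unique tendsto_const by blast
  then show "x \<in> (*\<^sub>R) t ` B" using l(1) by blast
qed

lemma body_norm_le_1_iff:
  assumes "symmetric_convex_body B" shows "body_norm B x \<le> 1 \<longleftrightarrow> x \<in> B"
  using body_norm_le_iff[OF assms, of 1 x] by simp

lemma body_norm_eq_0_iff:
  assumes "symmetric_convex_body B" shows "body_norm B x = 0 \<longleftrightarrow> x = 0"
proof -
  have "body_norm B x = 0 \<longleftrightarrow> body_norm B x \<le> 0" using body_norm_nonneg[OF assms, of x] by auto
  also have "\<dots> \<longleftrightarrow> x = 0"
    using body_norm_le_iff[OF assms order_refl, of x] symmetric_convex_body_zero[OF assms] by auto
  finally show ?thesis .
qed

lemma body_norm_scaleR:
  assumes "symmetric_convex_body B" shows "body_norm B (c *\<^sub>R x) = \<bar>c\<bar> * body_norm B x"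
proof (cases "c = 0")
  case True
  then show ?thesis using body_norm_eq_0_iff[OF assms, of 0] by simp
next
  case c0: False
  have le: "body_norm B (c *\<^sub>R x) \<le> \<bar>c\<bar> * body_norm B x" for c x
  proof -
    obtain b where b: "b \<in> B" "x = body_norm B x *\<^sub>R b"
      using body_norm_le_iff[OF assms body_norm_nonneg[OF assms], of x x] by auto
    have "sgn c *\<^sub>R b \<in> B"
      using b(1) assms symmetric_convex_body_zero[OF assms]
      by (cases c "0::real" rule: linorder_cases) (auto simp: symmetric_convex_body_def sgn_if)
    moreover have "c *\<^sub>R x = (\<bar>c\<bar> * body_norm B x) *\<^sub>R (sgn c *\<^sub>R b)"
      using arg_cong[OF b(2), of "(*\<^sub>R) c"] by (simp add: abs_mult_sgn mult.commute mult.left_commute)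
    ultimately have "c *\<^sub>R x \<in> (*\<^sub>R) (\<bar>c\<bar> * body_norm B x) ` B" by blast
    then show ?thesis
      using body_norm_nonneg[OF assms, of x] by (subst body_norm_le_iff[OF assms]) auto
  qed
  have "body_norm B x = body_norm B (inverse c *\<^sub>R (c *\<^sub>R x))" using c0 by simp
  also have "\<dots> \<le> \<bar>inverse c\<bar> * body_norm B (c *\<^sub>R x)" by (rule le)
  finally have "\<bar>c\<bar> * body_norm B x \<le> body_norm B (c *\<^sub>R x)"
    using c0 by (simp add: field_simps)
  then show ?thesis using le[of c x] by simp
qed

lemma body_norm_triangle:
  assumes "symmetric_convex_body B"
  shows "body_norm B (x + y) \<le> body_norm B x + body_norm B y"
proof -
  define s t where st: "s = body_norm B x" "t = body_norm B y"
  have nn: "0 \<le> s" "0 \<le> t" using body_norm_nonneg[OF assms] by (auto simp: st)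
  obtain b c where b: "b \<in> B" "x = s *\<^sub>R b" and c: "c \<in> B" "y = t *\<^sub>R c"
    using body_norm_le_iff[OF assms nn(1), of x] body_norm_le_iff[OF assms nn(2), of y]
    by (auto simp: st)
  show ?thesis
  proof (cases "s + t = 0")
    case True
    then have "x = 0" "y = 0" using b c nn by auto
    then show ?thesis using nn body_norm_eq_0_iff[OF assms, of 0] by (simp add: st)
  next
    case False
    have "(s/(s+t)) *\<^sub>R b + (t/(s+t)) *\<^sub>R c \<in> B"
      using assms b c nn False
      by (intro convexD) (auto simp: symmetric_convex_body_def simp flip: add_divide_distrib)
    moreover have "x + y = (s+t) *\<^sub>R ((s/(s+t)) *\<^sub>R b + (t/(s+t)) *\<^sub>R c)"
      using b c False by (simp add: scaleR_add_right)
    ultimately have "x + y \<in> (*\<^sub>R) (s+t) ` B" by blast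
    then show ?thesis using body_norm_le_iff[OF assms, of "s+t" "x+y"] nn by (simp add: st)
  qed
qed

lemma body_norm_bounds:
  assumes "symmetric_convex_body B"
  obtains m M where "0 < m" "0 < M" "\<And>x. body_norm B x \<le> M * norm x" "\<And>x. norm x \<le> m * body_norm B x"
proof -
  obtain r R where rR: "0 < r" "0 < R" "cball 0 r \<subseteq> B" "B \<subseteq> cball 0 R"
    using assms by (rule symmetric_convex_bodyE)
  have "body_norm B x \<le> (1/r) * norm x" for x
  proof (cases "x = 0")
    case True then show ?thesis using body_norm_eq_0_iff[OF assms, of 0] by simp
  next
    case False
    have "(r / norm x) *\<^sub>R x \<in> B" using rR False by (intro subsetD[OF rR(3)]) auto
    then have "body_norm B ((r / norm x) *\<^sub>R x) \<le> 1" using body_norm_le_1_iff[OF assms] by blast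
    then show ?thesis using rR False by (simp add: body_norm_scaleR[OF assms] field_simps)
  qed
  moreover have "norm x \<le> R * body_norm B x" for x
  proof -
    obtain b where b: "b \<in> B" "x = body_norm B x *\<^sub>R b"
      using body_norm_le_iff[OF assms body_norm_nonneg[OF assms], of x x] by auto
    have "norm x = body_norm B x * norm b"
      using arg_cong[OF b(2), of norm] body_norm_nonneg[OF assms, of x] by simp
    also have "\<dots> \<le> body_norm B x * R"
      using b(1) rR(4) body_norm_nonneg[OF assms, of x] by (intro mult_left_mono) auto
    finally show ?thesis by (simp add: mult.commute)
  qed
  ultimately show thesis using rR that[of R "1/r"] by simp
qed

lemma op_norm_bdd:
  assumes "symmetric_convex_body B" "symmetric_convex_body C" "linear T"
  shows "bdd_above ((\<lambda>x. body_norm C (T x)) ` {x. body_norm B x \<le> 1})"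
proof -
  obtain m1 where B: "0 < m1" "\<And>x. norm x \<le> m1 * body_norm B x"
    using body_norm_bounds[OF assms(1)] by metis
  obtain M2 where C: "0 < M2" "\<And>x. body_norm C x \<le> M2 * norm x"
    using body_norm_bounds[OF assms(2)] by metis
  obtain K where K: "0 < K" "\<And>x. norm (T x) \<le> K * norm x"
    using linear_bounded_pos[OF assms(3)] by blast
  have "body_norm C (T x) \<le> M2 * (K * m1)" if "body_norm B x \<le> 1" for x
  proof -
    have "norm x \<le> m1" using B that by (smt (verit) mult_left_le)
    then have "norm (T x) \<le> K * m1" using K by (meson less_imp_le mult_left_mono order_trans)
    then show ?thesis using C by (meson less_imp_le mult_left_mono order_trans)
  qed
  then show ?thesis by (intro bdd_aboveI2[of _ _ "M2 * (K * m1)"]) auto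
qed

lemma op_norm_bound:
  assumes "symmetric_convex_body B" "symmetric_convex_body C" "linear T"
  shows "body_norm C (T x) \<le> op_norm B C T * body_norm B x"
proof (cases "x = 0")
  case True
  then show ?thesis using assms body_norm_eq_0_iff linear_0 by (metis mult_zero_right order_refl)
next
  case False
  define t where "t = body_norm B x"
  have t: "0 < t"
    using False body_norm_nonneg[OF assms(1)] body_norm_eq_0_iff[OF assms(1)] by (auto simp: t_def less_le)
  have "body_norm B ((1/t) *\<^sub>R x) \<le> 1"
    using t by (simp add: body_norm_scaleR[OF assms(1)] t_def)
  then have "body_norm C (T ((1/t) *\<^sub>R x)) \<le> op_norm B C T"
    unfolding op_norm_def by (intro cSUP_upper op_norm_bdd[OF assms]) auto
  then show ?thesis
    using t by (simp add: linear_scale[OF assms(3)] body_norm_scaleR[OF assms(2)] t_def field_simps)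
qed

lemma op_norm_least:
  assumes "symmetric_convex_body B" "0 \<le> K" "\<And>x. body_norm C (T x) \<le> K * body_norm B x"
  shows "op_norm B C T \<le> K"
  unfolding op_norm_def
proof (rule cSUP_least)
  have "0 \<in> {x. body_norm B x \<le> 1}" using body_norm_eq_0_iff[OF assms(1), of 0] by simp
  then show "{x. body_norm B x \<le> 1} \<noteq> {}" by blast
  show "body_norm C (T x) \<le> K" if "x \<in> {x. body_norm B x \<le> 1}" for x
    using assms(2) assms(3)[of x] that by (smt (verit) mem_Collect_eq mult_left_le)
qed

lemma op_norm_pos:
  fixes T :: "'a::euclidean_space \<Rightarrow> 'a"
  assumes "symmetric_convex_body B" "symmetric_convex_body C" "linear T" "bij T"
  shows "0 < op_norm B C T"
proof -
  obtain x :: 'a where "x \<noteq> 0" using nonempty_Basis nonzero_Basis by blast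
  then have "T x \<noteq> 0" using assms(3,4) by (metis bij_is_inj injD linear_0)
  then have "0 < body_norm C (T x)" "0 < body_norm B x"
    using \<open>x \<noteq> 0\<close> body_norm_nonneg[OF assms(1), of x] body_norm_eq_0_iff[OF assms(1), of x]
      body_norm_nonneg[OF assms(2), of "T x"] body_norm_eq_0_iff[OF assms(2), of "T x"] by simp_all
  then show ?thesis using op_norm_bound[OF assms(1-3), of x]
    by (smt (verit) mult_nonpos_nonneg)
qed

lemma linear_inv_bij:
  fixes T :: "'a::euclidean_space \<Rightarrow> 'a"
  shows "linear T \<Longrightarrow> bij T \<Longrightarrow> linear (inv T)"
  using linear_linear by (metis bij_is_inj bij_is_surj inj_linear_imp_inv_linear)

lemma op_norm_inv_ge_1:
  fixes T :: "'a::euclidean_space \<Rightarrow> 'a"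
  assumes "symmetric_convex_body B" "symmetric_convex_body C" "linear T" "bij T"
  shows "1 \<le> op_norm B C T * op_norm C B (inv T)"
proof -
  obtain x :: 'a where "x \<noteq> 0" using nonempty_Basis nonzero_Basis by blast
  then have x: "0 < body_norm B x"
    using body_norm_nonneg[OF assms(1), of x] body_norm_eq_0_iff[OF assms(1), of x] by simp
  have "body_norm B x = body_norm B (inv T (T x))" using assms(4) by (simp add: bij_is_inj)
  also have "\<dots> \<le> op_norm C B (inv T) * body_norm C (T x)"
    using assms linear_inv_bij by (intro op_norm_bound) auto
  also have "\<dots> \<le> op_norm C B (inv T) * (op_norm B C T * body_norm B x)"
    using assms linear_inv_bij bij_imp_bij_inv
    by (intro mult_left_mono op_norm_bound less_imp_le[OF op_norm_pos]) auto
  finally show ?thesis using x by (simp add: field_simps)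
qed

lemma BM_dist_upper:
  assumes "symmetric_convex_body B" "symmetric_convex_body C" "linear T" "bij T"
  shows "BM_dist B C \<le> op_norm B C T * op_norm C B (inv T)"
  unfolding BM_dist_def
proof (rule cInf_lower)
  show "bdd_below {op_norm B C T * op_norm C B (inv T) |T. linear T \<and> bij T}"
    using op_norm_inv_ge_1[OF assms(1,2)] by (intro bdd_belowI[of _ 1]) auto
qed (use assms in auto)

lemma BM_dist_nonempty: "{op_norm B C T * op_norm C B (inv T) |T. linear T \<and> bij T} \<noteq> {}"
  using linear_id bij_id by blast

lemma BM_dist_greatest:
  assumes "\<And>T. linear T \<Longrightarrow> bij T \<Longrightarrow> K \<le> op_norm B C T * op_norm C B (inv T)"
  shows "K \<le> BM_dist B C"
  unfolding BM_dist_def using assms by (intro cInf_greatest[OF BM_dist_nonempty]) auto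

lemma BM_dist_ge_1:
  "symmetric_convex_body B \<Longrightarrow> symmetric_convex_body C \<Longrightarrow> 1 \<le> BM_dist B C"
  by (intro BM_dist_greatest op_norm_inv_ge_1)

lemma BM_dist_less:
  assumes "BM_dist B C < K"
  obtains T where "linear T" "bij T" "op_norm B C T * op_norm C B (inv T) < K"
  using cInf_lessD[OF BM_dist_nonempty, of B C K] assms unfolding BM_dist_def by blast

lemma BM_dist_commute: "BM_dist B C = BM_dist C B"
proof -
  have *: "{op_norm B C T * op_norm C B (inv T) | T. linear T \<and> bij T}
      \<subseteq> {op_norm C B T * op_norm B C (inv T) | T. linear T \<and> bij T}" for B C :: "'a set"
  proof clarify
    fix T :: "'a \<Rightarrow> 'a" assume "linear T" "bij T"
    then show "\<exists>S. op_norm B C T * op_norm C B (inv T) = op_norm C B S * op_norm B C (inv S)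
      \<and> linear S \<and> bij S"
      by (intro exI[of _ "inv T"]) (auto simp: inv_inv_eq bij_imp_bij_inv linear_inv_bij)
  qed
  then show ?thesis unfolding BM_dist_def by (intro arg_cong[of _ _ Inf] subset_antisym *)
qed

lemma BM_dist_triangle:
  assumes "symmetric_convex_body B" "symmetric_convex_body C" "symmetric_convex_body D"
  shows "BM_dist B D \<le> BM_dist B C * BM_dist C D"
proof -
  have pos: "0 < BM_dist X Y" if "symmetric_convex_body X" "symmetric_convex_body Y" for X Y :: "'a set"
    using BM_dist_ge_1[OF that] by linarith
  have key: "BM_dist B D \<le> (op_norm B C S * op_norm C B (inv S)) * (op_norm C D T * op_norm D C (inv T))"
    if "linear S" "bij S" "linear T" "bij T" for S T
  proof -
    have lin: "linear (inv S)" "linear (inv T)" "linear (T \<circ> S)" "bij (T \<circ> S)"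
      using that linear_inv_bij linear_compose bij_comp by auto
    note p = op_norm_pos[OF assms(1,2) that(1,2)] op_norm_pos[OF assms(2,3) that(3,4)]
      op_norm_pos[OF assms(2,1) lin(1) bij_imp_bij_inv[OF that(2)]]
      op_norm_pos[OF assms(3,2) lin(2) bij_imp_bij_inv[OF that(4)]]
    have "op_norm B D (T \<circ> S) \<le> op_norm C D T * op_norm B C S"
    proof (rule op_norm_least[OF assms(1)])
      fix x
      have "body_norm D (T (S x)) \<le> op_norm C D T * body_norm C (S x)"
        using op_norm_bound[OF assms(2,3) that(3)] .
      also have "\<dots> \<le> op_norm C D T * (op_norm B C S * body_norm B x)"
        using p by (intro mult_left_mono op_norm_bound[OF assms(1,2) that(1)]) auto
      finally show "body_norm D ((T \<circ> S) x) \<le> op_norm C D T * op_norm B C S * body_norm B x"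
        by (simp add: mult.assoc)
    qed (use p in simp)
    moreover have "op_norm D B (inv (T \<circ> S)) \<le> op_norm C B (inv S) * op_norm D C (inv T)"
    proof (rule op_norm_least[OF assms(3)])
      fix x
      have "body_norm B (inv S (inv T x)) \<le> op_norm C B (inv S) * body_norm C (inv T x)"
        using op_norm_bound[OF assms(2,1) lin(1)] .
      also have "\<dots> \<le> op_norm C B (inv S) * (op_norm D C (inv T) * body_norm D x)"
        using p by (intro mult_left_mono op_norm_bound[OF assms(3,2) lin(2)]) auto
      finally show "body_norm B (inv (T \<circ> S) x) \<le> op_norm C B (inv S) * op_norm D C (inv T) * body_norm D x"
        using that by (simp add: mult.assoc o_inv_distrib)
    qed (use p in simp)
    moreover have "0 < op_norm D B (inv (T \<circ> S))"
      using op_norm_pos[OF assms(3,1) linear_inv_bij[OF lin(3,4)] bij_imp_bij_inv[OF lin(4)]] .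
    ultimately have "op_norm B D (T \<circ> S) * op_norm D B (inv (T \<circ> S))
       \<le> (op_norm C D T * op_norm B C S) * (op_norm C B (inv S) * op_norm D C (inv T))"
      using p by (intro mult_mono) auto
    then show ?thesis using BM_dist_upper[OF assms(1,3) lin(3,4)] by (simp add: ac_simps)
  qed
  have "BM_dist B D / (op_norm C D T * op_norm D C (inv T)) \<le> BM_dist B C"
    if T: "linear T" "bij T" for T
  proof (rule BM_dist_greatest)
    fix S :: "'a \<Rightarrow> 'a" assume "linear S" "bij S"
    then show "BM_dist B D / (op_norm C D T * op_norm D C (inv T)) \<le> op_norm B C S * op_norm C B (inv S)"
      using key[OF _ _ T, of S] op_norm_inv_ge_1[OF assms(2,3) T] by (simp add: field_simps)
  qed
  then have "BM_dist B D / BM_dist B C \<le> BM_dist C D"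
    using pos[OF assms(1,2)] op_norm_inv_ge_1[OF assms(2,3)]
    by (intro BM_dist_greatest) (fastforce simp: field_simps)
  then show ?thesis using pos[OF assms(1,2)] by (simp add: field_simps)
qed

lemma isometric_bodies_imp_BM_dist_1:
  assumes "symmetric_convex_body B" "symmetric_convex_body C" "isometric_bodies B C"
  shows "BM_dist B C = 1"
proof -
  obtain T where T: "linear T" "bij T" "\<And>x. body_norm C (T x) = body_norm B x"
    using assms(3) by (auto simp: isometric_bodies_def)
  have "body_norm B (inv T x) = body_norm C x" for x
    using T(3)[of "inv T x"] T(2) by (simp add: bij_is_surj surj_f_inv_f)
  then have "op_norm B C T \<le> 1" "op_norm C B (inv T) \<le> 1"
    using T by (auto intro!: op_norm_least assms)
  moreover have "0 < op_norm C B (inv T)"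
    using op_norm_pos[OF assms(2,1) linear_inv_bij bij_imp_bij_inv] T by blast
  ultimately have "op_norm B C T * op_norm C B (inv T) \<le> 1"
    by (simp add: mult_le_one)
  then show ?thesis using BM_dist_upper[OF assms(1,2) T(1,2)] BM_dist_ge_1[OF assms(1,2)] by linarith
qed

lemma tendsto_body_norm:
  assumes "symmetric_convex_body B" "f \<longlonglongrightarrow> l"
  shows "(\<lambda>k. body_norm B (f k)) \<longlonglongrightarrow> body_norm B l"
proof -
  obtain M where M: "0 < M" "\<And>x. body_norm B x \<le> M * norm x"
    using body_norm_bounds[OF assms(1)] by metis
  have le: "body_norm B x - body_norm B y \<le> M * norm (x - y)" for x y
    using body_norm_triangle[OF assms(1), of "x - y" y] M(2)[of "x - y"] by simp
  have abs: "norm (body_norm B x - body_norm B y) \<le> M * norm (x - y)" for x y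
    using le[of x y] le[of y x] by (simp add: abs_le_iff norm_minus_commute)
  have "(\<lambda>k. M * norm (f k - l)) \<longlonglongrightarrow> M * norm (l - l)"
    by (intro tendsto_intros assms)
  then have "(\<lambda>k. M * norm (f k - l)) \<longlonglongrightarrow> 0" by simp
  then have "(\<lambda>k. body_norm B (f k) - body_norm B l) \<longlonglongrightarrow> 0"
    by (rule Lim_null_comparison[rotated]) (intro always_eventually allI abs)
  then show ?thesis by (simp add: LIM_zero_iff)
qed

lemma BM_dist_1_imp_isometric_bodies:
  fixes B C :: "'a::euclidean_space set"
  assumes B: "symmetric_convex_body B" and C: "symmetric_convex_body C" and d: "BM_dist B C = 1"
  shows "isometric_bodies B C"
proof -
  have "\<exists>T. linear T \<and> (\<forall>x. body_norm C (T x) \<le> body_norm B x)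
      \<and> (\<forall>x. body_norm B x \<le> (1 + inverse (real (Suc k))) * body_norm C (T x))" for k
  proof -
    obtain S where S: "linear S" "bij S"
      "op_norm B C S * op_norm C B (inv S) < 1 + inverse (real (Suc k))"
      using BM_dist_less[of B C "1 + inverse (real (Suc k))"] d by auto
    define a where "a = op_norm B C S"
    have a: "0 < a" using op_norm_pos[OF B C S(1,2)] by (simp add: a_def)
    define T where "T x = (1/a) *\<^sub>R S x" for x
    have "linear T" unfolding T_def using S(1) by (rule linear_compose_scale_right)
    moreover have "body_norm C (T x) \<le> body_norm B x" for x
      using op_norm_bound[OF B C S(1), of x] a
      by (simp add: T_def body_norm_scaleR[OF C] a_def[symmetric] field_simps)
    moreover have "body_norm B x \<le> (1 + inverse (real (Suc k))) * body_norm C (T x)" for x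
    proof -
      have "body_norm B x = body_norm B (inv S (S x))" using S by (simp add: bij_is_inj)
      also have "\<dots> \<le> op_norm C B (inv S) * body_norm C (S x)"
        by (intro op_norm_bound[OF C B] linear_inv_bij S)
      also have "\<dots> = (a * op_norm C B (inv S)) * body_norm C (T x)"
        using a by (simp add: T_def body_norm_scaleR[OF C])
      also have "\<dots> \<le> (1 + inverse (real (Suc k))) * body_norm C (T x)"
        using S(3) body_norm_nonneg[OF C] by (intro mult_right_mono) (auto simp: a_def)
      finally show ?thesis .
    qed
    ultimately show ?thesis by blast
  qed
  then obtain T where T: "\<And>k. linear (T k)" "\<And>k x. body_norm C (T k x) \<le> body_norm B x"
    "\<And>k x. body_norm B x \<le> (1 + inverse (real (Suc k))) * body_norm C (T k x)" by metis
  define F where "F k = Blinfun (T k)" for k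
  have F: "blinfun_apply (F k) = T k" for k
    using T(1) by (simp add: F_def bounded_linear_Blinfun_apply linear_conv_bounded_linear)
  obtain m where m: "0 < m" "\<And>x. norm x \<le> m * body_norm C x" using body_norm_bounds[OF C] by metis
  obtain M where M: "0 < M" "\<And>x. body_norm B x \<le> M * norm x" using body_norm_bounds[OF B] by metis
  have "norm (F k) \<le> m * M" for k
  proof (rule norm_blinfun_bound)
    show "norm (F k x) \<le> m * M * norm x" for x
      using m(2)[of "T k x"] T(2)[of k x] M(2)[of x] m(1)
      by (smt (verit) F mult.assoc mult_left_mono)
  qed (use m M in simp)
  then have "bounded (range F)" by (auto simp: bounded_iff)
  then obtain L r where L: "strict_mono r" "(F \<circ> r) \<longlonglongrightarrow> L"
    using bounded_imp_convergent_subsequence by blast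
  have lim: "(\<lambda>k. T (r k) x) \<longlonglongrightarrow> L x" for x
    using blinfun.tendsto[OF L(2) tendsto_const[of x]] F by simp
  have "(\<lambda>k. inverse (real (Suc (r k)))) \<longlonglongrightarrow> 0"
    using LIMSEQ_subseq_LIMSEQ[OF LIMSEQ_inverse_real_of_nat L(1)] by (simp add: o_def)
  then have lim2: "(\<lambda>k. (1 + inverse (real (Suc (r k)))) * body_norm C (T (r k) x))
      \<longlonglongrightarrow> (1 + 0) * body_norm C (L x)" for x
    by (intro tendsto_intros tendsto_body_norm[OF C] lim)
  have eq: "body_norm C (L x) = body_norm B x" for x
  proof (rule antisym)
    show "body_norm C (L x) \<le> body_norm B x"
      using T(2) by (intro LIMSEQ_le_const2[OF tendsto_body_norm[OF C lim]]) auto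
    show "body_norm B x \<le> body_norm C (L x)"
      using T(3) LIMSEQ_le_const[OF lim2[of x], of "body_norm B x"] by auto
  qed
  have lin: "linear (blinfun_apply L)" using blinfun.bounded_linear_right bounded_linear.linear by blast
  have "inj (blinfun_apply L)"
    unfolding linear_injective_0[OF lin] using eq body_norm_eq_0_iff B C by metis
  then have "bij (blinfun_apply L)"
    using lin linear_injective_imp_surjective by (auto simp: bij_def)
  then show ?thesis using lin eq by (auto simp: isometric_bodies_def)
qed

definition isometry_rel :: "('a::euclidean_space set \<times> 'a set) set" where
  "isometry_rel = {(B, C). symmetric_convex_body B \<and> symmetric_convex_body C \<and> isometric_bodies B C}"

definition BM_class :: "'a::euclidean_space set \<Rightarrow> 'a set set" where
  "BM_class B = isometry_rel `` {B}"

definition BM_space :: "'a::euclidean_space set set set" where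
  "BM_space = {B. symmetric_convex_body B} // isometry_rel"

text \<open>Representatives are chosen arbitrarily; by \<open>log_BM_class\<close> below the choice is immaterial.\<close>

definition log_BM :: "'a::euclidean_space set set \<Rightarrow> 'a set set \<Rightarrow> real" where
  "log_BM X Y = (if X \<in> BM_space \<and> Y \<in> BM_space
     then ln (BM_dist (SOME B. B \<in> X) (SOME C. C \<in> Y)) else 0)"

lemma isometry_rel_iff:
  "(B, C) \<in> isometry_rel \<longleftrightarrow> symmetric_convex_body B \<and> symmetric_convex_body C \<and> BM_dist B C = 1"
  using BM_dist_1_imp_isometric_bodies isometric_bodies_imp_BM_dist_1
  by (auto simp: isometry_rel_def)

lemma isometric_bodies_refl: "isometric_bodies B B"
  unfolding isometric_bodies_def by (intro exI[of _ id]) (auto simp: linear_id)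

lemma equiv_isometry_rel:
  "equiv {B :: 'a::euclidean_space set. symmetric_convex_body B} isometry_rel"
proof (rule equivI)
  show "isometry_rel \<subseteq> {B. symmetric_convex_body B} \<times> {B. symmetric_convex_body B}"
    by (auto simp: isometry_rel_def)
  show "refl_on {B. symmetric_convex_body B} isometry_rel"
    by (auto simp: refl_on_def isometry_rel_def isometric_bodies_refl)
  show "sym isometry_rel" by (auto simp: sym_def isometry_rel_iff BM_dist_commute)
  show "trans (isometry_rel :: ('a set \<times> 'a set) set)"
  proof (rule transI)
    fix B C D :: "'a set"
    assume "(B, C) \<in> isometry_rel" "(C, D) \<in> isometry_rel"
    then show "(B, D) \<in> isometry_rel"
      using BM_dist_triangle[of B C D] BM_dist_ge_1[of B D] by (simp add: isometry_rel_iff)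
  qed
qed

lemma BM_class_in_BM_space: "symmetric_convex_body B \<Longrightarrow> BM_class B \<in> BM_space"
  by (auto simp: BM_class_def BM_space_def quotient_def)

lemma BM_space_cases:
  assumes "X \<in> BM_space"
  obtains B where "symmetric_convex_body B" "X = BM_class B"
  using assms by (auto simp: BM_class_def BM_space_def quotient_def)

lemma BM_dist_cong:
  assumes "(B, B') \<in> isometry_rel" "(C, C') \<in> isometry_rel"
  shows "BM_dist B' C' = BM_dist B C"
proof -
  have *: "BM_dist B C \<le> BM_dist B' C'" if "(B, B') \<in> isometry_rel" "(C, C') \<in> isometry_rel"
    for B B' C C' :: "'a set"
    using BM_dist_triangle[of B B' C] BM_dist_triangle[of B' C' C] that
    by (auto simp: isometry_rel_iff BM_dist_commute[of C' C])
  show ?thesis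
    using *[OF assms] * assms equiv_isometry_rel by (metis equivE order_antisym symD)
qed

lemma log_BM_class:
  assumes "symmetric_convex_body B" "symmetric_convex_body C"
  shows "log_BM (BM_class B) (BM_class C) = ln (BM_dist B C)"
proof -
  have some: "(X, SOME Y. Y \<in> BM_class X) \<in> isometry_rel" if "symmetric_convex_body X" for X :: "'a set"
  proof -
    have "X \<in> BM_class X" using that by (simp add: BM_class_def isometry_rel_def isometric_bodies_refl)
    then have "(SOME Y. Y \<in> BM_class X) \<in> BM_class X" by (rule someI)
    then show ?thesis by (simp add: BM_class_def)
  qed
  show ?thesis
    using BM_dist_cong[OF some[OF assms(1)] some[OF assms(2)]] assms
    by (simp add: log_BM_def BM_class_in_BM_space)
qed

global_interpretation BM: Metric_space BM_space log_BM
proof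
  show "0 \<le> log_BM X Y" for X Y :: "'a set set"
  proof (cases "X \<in> BM_space \<and> Y \<in> BM_space")
    case True
    then show ?thesis by (auto elim!: BM_space_cases simp: log_BM_class BM_dist_ge_1)
  qed (auto simp: log_BM_def)
  show "log_BM X Y = log_BM Y X" for X Y :: "'a set set"
    by (auto simp: log_BM_def BM_dist_commute)
  show "log_BM X Y = 0 \<longleftrightarrow> X = Y" if "X \<in> BM_space" "Y \<in> BM_space" for X Y :: "'a set set"
  proof -
    obtain B C where BC: "symmetric_convex_body B" "X = BM_class B" "symmetric_convex_body C" "Y = BM_class C"
      using \<open>X \<in> BM_space\<close> \<open>Y \<in> BM_space\<close> by (elim BM_space_cases) blast
    have "log_BM X Y = 0 \<longleftrightarrow> BM_dist B C = 1"
      using BC BM_dist_ge_1[OF BC(1,3)] by (simp add: log_BM_class)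
    also have "\<dots> \<longleftrightarrow> (B, C) \<in> isometry_rel" using BC by (simp add: isometry_rel_iff)
    also have "\<dots> \<longleftrightarrow> X = Y"
      using BC eq_equiv_class_iff[OF equiv_isometry_rel] by (auto simp: BM_class_def)
    finally show ?thesis .
  qed
  show "log_BM X Z \<le> log_BM X Y + log_BM Y Z"
    if "X \<in> BM_space" "Y \<in> BM_space" "Z \<in> BM_space" for X Y Z :: "'a set set"
  proof -
    obtain B where B: "symmetric_convex_body B" "X = BM_class B"
      using \<open>X \<in> BM_space\<close> by (rule BM_space_cases)
    obtain C where C: "symmetric_convex_body C" "Y = BM_class C"
      using \<open>Y \<in> BM_space\<close> by (rule BM_space_cases)
    obtain D where D: "symmetric_convex_body D" "Z = BM_class D"
      using \<open>Z \<in> BM_space\<close> by (rule BM_space_cases)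
    note BC = B C D
    have "1 \<le> BM_dist B C" "1 \<le> BM_dist C D" "1 \<le> BM_dist B D" using BC BM_dist_ge_1 by auto
    moreover from this have "ln (BM_dist B D) \<le> ln (BM_dist B C * BM_dist C D)"
      using BM_dist_triangle BC by (subst ln_le_cancel_iff) auto
    ultimately show ?thesis using BC by (simp add: log_BM_class ln_mult)
  qed
qed

context Metric_space
begin

definition path_length :: "real \<Rightarrow> real \<Rightarrow> (real \<Rightarrow> 'a) \<Rightarrow> ereal" where
  "path_length a b \<gamma> =
     Sup {ereal (\<Sum>i = 1..m. d (\<gamma> (t i)) (\<gamma> (t (i - 1)))) | (m::nat) (t :: nat \<Rightarrow> real).
            t 0 = a \<and> t m = b \<and> (\<forall>i\<in>{1..m}. t (i - 1) \<le> t i)}"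

definition geodesic :: "real \<Rightarrow> real \<Rightarrow> (real \<Rightarrow> 'a) \<Rightarrow> 'a \<Rightarrow> 'a \<Rightarrow> bool" where
  "geodesic a b \<gamma> x y \<longleftrightarrow>
     a \<le> b \<and> continuous_map (top_of_set {a..b}) mtopology \<gamma> \<and> \<gamma> a = x \<and> \<gamma> b = y \<and>
     path_length a b \<gamma> = ereal (d x y)"

end

end

(* Both families increase with l and satisfy A t \<subseteq> D powr (t - s) A s for s \<le> t, where
   D = BM_dist B_E B_F. Testing the distance on the identity map makes them Lipschitz with
   constant ln D for the metric log d. As ln D is also the distance between the end points, the
   triangle inequality forces the length to be ln D. *)

theory Submission
  imports Defs
begin

text \<open>Over any partition the Lipschitz bounds telescope to \<open>L * (b - a)\<close>, which
  by \<open>dist\<close> is the distance of the end points, and the one-step partition attains this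
  value. The same bounds give continuity.\<close>

lemma (in Metric_space) geodesicI_Lipschitz:
  assumes "a \<le> b" and in_M: "\<And>s. s \<in> {a..b} \<Longrightarrow> \<gamma> s \<in> M"
    and Lip: "\<And>s t. a \<le> s \<Longrightarrow> s \<le> t \<Longrightarrow> t \<le> b \<Longrightarrow> d (\<gamma> s) (\<gamma> t) \<le> L * (t - s)"
    and dist: "d (\<gamma> a) (\<gamma> b) = L * (b - a)" and "0 \<le> L"
  shows "geodesic a b \<gamma> (\<gamma> a) (\<gamma> b)"
proof -
  have Lip_abs: "d (\<gamma> s) (\<gamma> t) \<le> L * \<bar>t - s\<bar>" if "s \<in> {a..b}" "t \<in> {a..b}" for s t
    using Lip[of s t] Lip[of t s] that by (cases "s \<le> t") (auto simp: commute)
  have "continuous_map (top_of_set {a..b}) mtopology \<gamma>"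
    unfolding continuous_map_to_metric
  proof (intro ballI allI impI)
    fix s \<epsilon> :: real
    assume s: "s \<in> topspace (top_of_set {a..b})" and "0 < \<epsilon>"
    \<comment> \<open>\<open>L\<close> may be 0, so the radius is divided by
      \<open>L + 1\<close>.\<close>
    define \<delta> where "\<delta> = \<epsilon> / (L + 1)"
    have "\<gamma> t \<in> mball (\<gamma> s) \<epsilon>" if t: "t \<in> {a..b} \<inter> ball s \<delta>" for t
    proof -
      have "d (\<gamma> s) (\<gamma> t) \<le> L * \<bar>t - s\<bar>" using Lip_abs s t by auto
      also have "\<dots> \<le> (L + 1) * \<bar>t - s\<bar>" by (simp add: mult_right_mono)
      also have "\<dots> < (L + 1) * \<delta>"
        using t \<open>0 \<le> L\<close> by (intro mult_strict_left_mono) (auto simp: dist_real_def)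
      also have "\<dots> = \<epsilon>" using \<open>0 \<le> L\<close> by (simp add: \<delta>_def)
      finally show ?thesis using in_M s t by auto
    qed
    moreover have "s \<in> {a..b} \<inter> ball s \<delta>"
      using s \<open>0 < \<epsilon>\<close> \<open>0 \<le> L\<close> by (auto simp: \<delta>_def)
    moreover have "openin (top_of_set {a..b}) ({a..b} \<inter> ball s \<delta>)"
      by (simp add: openin_open_Int)
    ultimately show "\<exists>U. openin (top_of_set {a..b}) U \<and> s \<in> U \<and> (\<forall>t\<in>U. \<gamma> t \<in> mball (\<gamma> s) \<epsilon>)"
      by blast
  qed
  moreover have "path_length a b \<gamma> = ereal (d (\<gamma> a) (\<gamma> b))"
    unfolding path_length_def
  proof (rule antisym)
    show "Sup {ereal (\<Sum>i = 1..m. d (\<gamma> (t i)) (\<gamma> (t (i - 1)))) | (m::nat) (t :: nat \<Rightarrow> real).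
            t 0 = a \<and> t m = b \<and> (\<forall>i\<in>{1..m}. t (i - 1) \<le> t i)} \<le> ereal (d (\<gamma> a) (\<gamma> b))"
    proof (rule Sup_least, clarify)
      fix m :: nat and t :: "nat \<Rightarrow> real"
      assume t: "a = t 0" "b = t m" "\<forall>i\<in>{1..m}. t (i - 1) \<le> t i"
      \<comment> \<open>Only consecutive nodes are known to be ordered. Monotonicity up to index
        \<open>m\<close> places every node in \<open>[a, b]\<close>, where \<open>Lip\<close>
        applies.\<close>
      have mono: "t i \<le> t j" if "i \<le> j" "j \<le> m" for i j
        using that
      proof (induction j rule: dec_induct)
        case (step k)
        then show ?case using t(3)[rule_format, of "Suc k"] by simp
      qed simp
      have "(\<Sum>i = 1..m. d (\<gamma> (t i)) (\<gamma> (t (i - 1)))) \<le> (\<Sum>i = 1..m. L * (t i - t (i - 1)))"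
      proof (rule sum_mono)
        fix i assume "i \<in> {1..m}"
        then have "d (\<gamma> (t (i - 1))) (\<gamma> (t i)) \<le> L * (t i - t (i - 1))"
          by (intro Lip) (auto simp: t(1,2) intro: mono)
        then show "d (\<gamma> (t i)) (\<gamma> (t (i - 1))) \<le> L * (t i - t (i - 1))"
          by (simp add: commute)
      qed
      also have "\<dots> = L * (t m - t 0)"
        using sum_telescope''[of 0 m t] by (simp flip: sum_distrib_left)
      finally show "ereal (\<Sum>i = 1..m. d (\<gamma> (t i)) (\<gamma> (t (i - 1)))) \<le> ereal (d (\<gamma> (t 0)) (\<gamma> (t m)))"
        using dist t by simp
    qed
  next
    show "ereal (d (\<gamma> a) (\<gamma> b)) \<le> Sup {ereal (\<Sum>i = 1..m. d (\<gamma> (t i)) (\<gamma> (t (i - 1)))) | (m::nat) (t :: nat \<Rightarrow> real).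
            t 0 = a \<and> t m = b \<and> (\<forall>i\<in>{1..m}. t (i - 1) \<le> t i)}"
      \<comment> \<open>The partition with the single step from \<open>a\<close> to \<open>b\<close>
        realises the distance of the end points.\<close>
      by (rule Sup_upper, clarify, rule exI[of _ 1], rule exI[of _ "\<lambda>i. if i = 0 then a else b"])
        (use \<open>a \<le> b\<close> commute in auto)
  qed
  ultimately show ?thesis
    using \<open>a \<le> b\<close> by (simp add: geodesic_def)
qed

text \<open>A ball about the origin is easier to carry through scaling, intersection and convex hull
  than a nonempty interior: for an intersection, two balls with the same centre leave the smaller
  one.\<close>

lemma symmetric_convex_bodyI:
  assumes "convex B" "compact B" "0 < r" "cball 0 r \<subseteq> B" "\<And>x. x \<in> B \<Longrightarrow> - x \<in> B"
  shows "symmetric_convex_body B"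
proof -
  have "0 \<in> interior B" using assms(3,4) mem_interior_cball by blast
  then have "interior B \<noteq> {}" by blast
  moreover have "uminus ` B = B" using assms(5) by force
  ultimately show ?thesis using assms by (simp add: symmetric_convex_body_def)
qed

lemma symmetric_convex_body_uminus:
  "symmetric_convex_body B \<Longrightarrow> x \<in> B \<Longrightarrow> - x \<in> B"
  unfolding symmetric_convex_body_def by blast

lemma symmetric_convex_body_scaleR:
  assumes "symmetric_convex_body B" "0 < c"
  shows "symmetric_convex_body ((*\<^sub>R) c ` B)"
proof -
  obtain r where r: "0 < r" "cball 0 r \<subseteq> B" using assms by (metis symmetric_convex_bodyE)
  show ?thesis
  proof (rule symmetric_convex_bodyI)
    show "cball 0 (c * r) \<subseteq> (*\<^sub>R) c ` B"
    proof
      fix x :: 'a assume "x \<in> cball 0 (c * r)"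
      then have "inverse c *\<^sub>R x \<in> B"
        using assms(2) by (intro subsetD[OF r(2)]) (simp add: field_simps)
      then have "c *\<^sub>R inverse c *\<^sub>R x \<in> (*\<^sub>R) c ` B" by (rule imageI)
      then show "x \<in> (*\<^sub>R) c ` B" using assms(2) by simp
    qed
    show "- x \<in> (*\<^sub>R) c ` B" if x: "x \<in> (*\<^sub>R) c ` B" for x
    proof -
      obtain b where "b \<in> B" "x = c *\<^sub>R b" using x by blast
      then have "- x = c *\<^sub>R (- b)" "- b \<in> B"
        using symmetric_convex_body_uminus[OF assms(1)] by auto
      then show ?thesis by blast
    qed
  qed (use assms r in \<open>auto simp: symmetric_convex_body_def intro: convex_scaling compact_scaling\<close>)
qed

lemma symmetric_convex_body_Int:
  assumes "symmetric_convex_body B" "symmetric_convex_body C"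
  shows "symmetric_convex_body (B \<inter> C)"
proof -
  obtain r s where "0 < r" "cball 0 r \<subseteq> B" "0 < s" "cball 0 s \<subseteq> C"
    using assms by (metis symmetric_convex_bodyE)
  then have "0 < min r s" "cball 0 (min r s) \<subseteq> B \<inter> C" by auto
  then show ?thesis
    using assms symmetric_convex_body_uminus
    by (intro symmetric_convex_bodyI[of _ "min r s"])
      (auto simp: symmetric_convex_body_def intro: convex_Int compact_Int)
qed

text \<open>Negation is linear, hence commutes with convex hulls, and in finite dimension the hull
  of a compact set is compact.\<close>

lemma symmetric_convex_body_convex_hull_Un:
  assumes "symmetric_convex_body B" "symmetric_convex_body C"
  shows "symmetric_convex_body (convex hull (B \<union> C))"
proof -
  obtain r where r: "0 < r" "cball 0 r \<subseteq> B" using assms by (metis symmetric_convex_bodyE)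
  have "uminus ` (convex hull (B \<union> C)) = convex hull (uminus ` (B \<union> C))"
    by (intro convex_hull_linear_image linear_uminus)
  also have "uminus ` (B \<union> C) = B \<union> C"
    using assms by (simp add: symmetric_convex_body_def image_Un)
  finally have "- x \<in> convex hull (B \<union> C)" if "x \<in> convex hull (B \<union> C)" for x
    using that by blast
  moreover have "cball 0 r \<subseteq> convex hull (B \<union> C)"
    using r(2) hull_subset[of "B \<union> C" convex] by blast
  moreover have "compact (convex hull (B \<union> C))"
    using assms by (intro compact_convex_hull compact_Un) (auto simp: symmetric_convex_body_def)
  ultimately show ?thesis
    using r(1) by (intro symmetric_convex_bodyI[of _ r] convex_convex_hull) auto
qed

lemma scaleR_body_mono:
  assumes "symmetric_convex_body B" "0 \<le> s" "s \<le> t"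
  shows "(*\<^sub>R) s ` B \<subseteq> (*\<^sub>R) t ` B"
  using body_norm_set_mono[OF assms(1)] assms(2,3) by blast

text \<open>The identity is the test map: the first inclusion bounds its norm by 1, the second
  bounds the norm of its inverse by \<open>c\<close>.\<close>

lemma BM_dist_le_if_sandwich:
  assumes "symmetric_convex_body B" "symmetric_convex_body C" "0 \<le> c"
    and "B \<subseteq> C" "C \<subseteq> (*\<^sub>R) c ` B"
  shows "BM_dist B C \<le> c"
proof -
  \<comment> \<open>A point \<open>x\<close> lies in its own \<open>X\<close>-norm times
    \<open>X\<close>, hence in \<open>k\<close> times that norm times \<open>Y\<close>.\<close>
  have *: "body_norm Y x \<le> k * body_norm X x"
    if "symmetric_convex_body X" "symmetric_convex_body Y" "0 \<le> k" "X \<subseteq> (*\<^sub>R) k ` Y" for X Y k x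
  proof -
    have "x \<in> (*\<^sub>R) (body_norm X x) ` X"
      using body_norm_le_iff[OF that(1) body_norm_nonneg[OF that(1)]] by blast
    also have "\<dots> \<subseteq> (*\<^sub>R) (body_norm X x) ` (*\<^sub>R) k ` Y" using that(4) by blast
    finally have "x \<in> (*\<^sub>R) (k * body_norm X x) ` Y" by (simp add: image_image mult.commute)
    then show ?thesis
      using that body_norm_nonneg[OF that(1)] by (subst body_norm_le_iff) auto
  qed
  have "op_norm B C id \<le> 1"
    using *[of B C 1] assms by (intro op_norm_least) auto
  moreover have "op_norm C B (inv id) \<le> c"
    using *[of C B c] assms by (intro op_norm_least) auto
  moreover have "0 < op_norm C B (inv id)"
    using op_norm_pos[OF assms(2,1) linear_id bij_id] by simp
  ultimately have "op_norm B C id * op_norm C B (inv id) \<le> 1 * c"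
    by (intro mult_mono) auto
  then show ?thesis
    using BM_dist_upper[OF assms(1,2) linear_id bij_id] by linarith
qed

text \<open>The logarithm turns the factor \<open>D powr (t - s)\<close> into the Lipschitz bound
  \<open>ln D * (t - s)\<close>. Since \<open>D\<close> is the distance of the end bodies and the
  parameter interval has length 1, this constant is exactly the one a geodesic requires. Both
  families satisfy the inclusions for all real parameters, so no range conditions appear.\<close>

lemma BM_geodesic_if_sandwich:
  fixes A :: "real \<Rightarrow> 'a::euclidean_space set"
  assumes body: "\<And>s. symmetric_convex_body (A s)"
    and D: "D = BM_dist (A 0) (A 1)"
    and mono: "\<And>s t. s \<le> t \<Longrightarrow> A s \<subseteq> A t"
    and exp: "\<And>s t. s \<le> t \<Longrightarrow> A t \<subseteq> (*\<^sub>R) (D powr (t - s)) ` A s"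
  shows "BM.geodesic 0 1 (\<lambda>s. BM_class (A s)) (BM_class (A 0)) (BM_class (A 1))"
proof (rule BM.geodesicI_Lipschitz[where L = "ln D"])
  have D1: "1 \<le> D" using BM_dist_ge_1 body D by blast
  then show "0 \<le> ln D" by simp
  show "log_BM (BM_class (A 0)) (BM_class (A 1)) = ln D * (1 - 0)"
    by (simp add: log_BM_class body D)
  fix s t :: real assume "s \<le> t"
  then have "BM_dist (A s) (A t) \<le> D powr (t - s)"
    by (intro BM_dist_le_if_sandwich body mono exp) auto
  moreover have "1 \<le> BM_dist (A s) (A t)" using BM_dist_ge_1 body by blast
  ultimately have "ln (BM_dist (A s) (A t)) \<le> ln (D powr (t - s))"
    by (subst ln_le_cancel_iff) linarith+
  also have "\<dots> = ln D * (t - s)" by simp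
  finally show "log_BM (BM_class (A s)) (BM_class (A t)) \<le> ln D * (t - s)"
    by (simp add: log_BM_class body)
qed (simp_all add: BM_class_in_BM_space body)

theorem corollary1:
  fixes B_E B_F :: "(real ^ 'n) set"
  assumes "symmetric_convex_body B_E" and "symmetric_convex_body B_F"
    and "\<not> isometric_bodies B_E B_F"
    and "B_E \<subseteq> B_F" and "B_F \<subseteq> (*\<^sub>R) (BM_dist B_E B_F) ` B_E"
  shows "BM.geodesic 0 1
           (\<lambda>l. BM_class (((*\<^sub>R) (BM_dist B_E B_F powr l) ` B_E) \<inter> B_F))
           (BM_class B_E) (BM_class B_F) \<and>
         BM.geodesic 0 1
           (\<lambda>l. BM_class (convex hull (B_E \<union> (*\<^sub>R) (1 / BM_dist B_E B_F powr (1 - l)) ` B_F)))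
           (BM_class B_E) (BM_class B_F)"
proof -
  note E = assms(1) and F = assms(2)
  define D where "D = BM_dist B_E B_F"
  have D1: "1 \<le> D" using BM_dist_ge_1[OF E F] by (simp add: D_def)
  have pow_mono: "D powr s \<le> D powr t" if "s \<le> t" for s t
    using D1 that by (simp add: powr_mono)
  have subset_scaled: "X \<subseteq> (*\<^sub>R) (D powr s) ` X"
    if "symmetric_convex_body X" "0 \<le> s" for X :: "(real ^ 'n) set" and s
    using scaleR_body_mono[OF that(1), of 1 "D powr s"] pow_mono[OF that(2)] D1 by simp
  \<comment> \<open>As a power of \<open>D\<close>, the coefficient of \<open>B_F\<close> in the
    hull combines with other scalings by adding exponents.\<close>
  have inv_powr: "1 / D powr (1 - l) = D powr (l - 1)" for l
    by (simp add: powr_minus_divide[symmetric])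

  define A where "A l = ((*\<^sub>R) (D powr l) ` B_E) \<inter> B_F" for l
  \<comment> \<open>The two inclusions between \<open>B_E\<close> and \<open>B_F\<close> make one
    set of the intersection redundant at each end.\<close>
  have A01: "A 0 = B_E" "A 1 = B_F" using assms(4,5) D1 by (auto simp: A_def D_def)
  have geodesic_A: "BM.geodesic 0 1 (\<lambda>l. BM_class (A l)) (BM_class (A 0)) (BM_class (A 1))"
  proof (rule BM_geodesic_if_sandwich)
    show "symmetric_convex_body (A l)" for l
      unfolding A_def using D1 E F
      by (intro symmetric_convex_body_Int symmetric_convex_body_scaleR) auto
    show "D = BM_dist (A 0) (A 1)" by (simp add: A01 D_def)
    fix s t :: real assume st: "s \<le> t"
    show "A s \<subseteq> A t"
      using scaleR_body_mono[OF E, of "D powr s" "D powr t"] pow_mono[OF st] by (auto simp: A_def)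
    \<comment> \<open>The exponents \<open>t - s\<close> and \<open>s\<close> add up to
      \<open>t\<close> on \<open>B_E\<close>, while \<open>B_F\<close> only grows under a factor of
      at least 1.\<close>
    have "A t \<subseteq> ((*\<^sub>R) (D powr (t - s)) ` (*\<^sub>R) (D powr s) ` B_E) \<inter> (*\<^sub>R) (D powr (t - s)) ` B_F"
      using subset_scaled[OF F, of "t - s"] st by (auto simp: A_def image_image simp flip: powr_add)
    \<comment> \<open>Scaling by a positive factor is injective, so it commutes with the
      intersection.\<close>
    also have "\<dots> = (*\<^sub>R) (D powr (t - s)) ` A s"
      using D1 by (auto simp: A_def intro!: image_Int[symmetric] injI)
    finally show "A t \<subseteq> (*\<^sub>R) (D powr (t - s)) ` A s" .
  qed

  define C where "C l = convex hull (B_E \<union> (*\<^sub>R) (1 / D powr (1 - l)) ` B_F)" for l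
  \<comment> \<open>By minimality of the hull, each inclusion of \<open>C l\<close> in a convex set
    is checked on the two generating sets alone.\<close>
  have C_sub: "C l \<subseteq> X \<longleftrightarrow> B_E \<subseteq> X \<and> (*\<^sub>R) (D powr (l - 1)) ` B_F \<subseteq> X" if "convex X" for l X
    using subset_hull[of convex X] that by (simp add: C_def inv_powr)
  have C_sup: "B_E \<subseteq> C l" "(*\<^sub>R) (D powr (l - 1)) ` B_F \<subseteq> C l" for l
    using C_sub[of "C l" l] by (auto simp: C_def)
  have body: "symmetric_convex_body (C l)" for l
    unfolding C_def using D1 E F
    by (intro symmetric_convex_body_convex_hull_Un symmetric_convex_body_scaleR) auto
  \<comment> \<open>At parameter 0 the shrunken \<open>B_F\<close> already lies in
    \<open>B_E\<close>, so the hull adds nothing. The exponent stays \<open>0 - 1\<close> to match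
    \<open>C_sub\<close> and \<open>C_sup\<close>.\<close>
  have "(*\<^sub>R) (D powr (0 - 1)) ` B_F \<subseteq> (*\<^sub>R) (D powr (0 - 1)) ` (*\<^sub>R) D ` B_E"
    using assms(5) unfolding D_def by (intro image_mono)
  also have "\<dots> = B_E" using D1 by (simp add: image_image powr_minus)
  finally have C0: "C 0 = B_E"
    using C_sub[of B_E 0] C_sup(1)[of 0] E by (auto simp: symmetric_convex_body_def)
  \<comment> \<open>Here the coefficient is \<open>D powr 0\<close>, that is 1, and
    \<open>B_F\<close> absorbs \<open>B_E\<close>.\<close>
  have C1: "C 1 = B_F"
    using C_sub[of B_F 1] C_sup(2)[of 1] F assms(4) D1 by (auto simp: symmetric_convex_body_def)
  have geodesic_C: "BM.geodesic 0 1 (\<lambda>l. BM_class (C l)) (BM_class (C 0)) (BM_class (C 1))"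
  proof (rule BM_geodesic_if_sandwich[OF body])
    show "D = BM_dist (C 0) (C 1)"
      by (simp add: C0 C1 D_def)
    fix s t :: real assume st: "s \<le> t"
    have "(*\<^sub>R) (D powr (s - 1)) ` B_F \<subseteq> (*\<^sub>R) (D powr (t - 1)) ` B_F"
      using st by (intro scaleR_body_mono[OF F] pow_mono) auto
    then show "C s \<subseteq> C t"
      using C_sub[of "C t" s] C_sup[of t] body[of t] by (auto simp: symmetric_convex_body_def)
    \<comment> \<open>The roles are swapped compared with the intersection: \<open>B_E\<close> is
      the set that merely grows, while on \<open>B_F\<close> the exponents \<open>t - s\<close> and
      \<open>s - 1\<close> add up to \<open>t - 1\<close>.\<close>
    have "B_E \<subseteq> (*\<^sub>R) (D powr (t - s)) ` C s"
      using subset_scaled[OF E, of "t - s"] image_mono[OF C_sup(1)[of s]] st by fastforce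
    moreover have "(*\<^sub>R) (D powr (t - 1)) ` B_F \<subseteq> (*\<^sub>R) (D powr (t - s)) ` C s"
      using image_mono[OF C_sup(2)[of s], of "(*\<^sub>R) (D powr (t - s))"]
      by (simp add: image_image flip: powr_add)
    ultimately show "C t \<subseteq> (*\<^sub>R) (D powr (t - s)) ` C s"
      using body[of s] by (subst C_sub) (auto simp: symmetric_convex_body_def intro: convex_scaling)
  qed
  show ?thesis
    using geodesic_A geodesic_C unfolding A01 C0 C1 by (simp add: A_def C_def D_def)
qed

end
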